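(* Let $A$ be a finite alphabet. (i) For every cellular automaton $F$ on $A^{\mathbb{Z}^2}$ and every positive integer $k$, $$ER(A^{\mathbb{Z}^2},F^k)=k\cdot ER(A^{\mathbb{Z}^2},F).$$ (ii) For every cellular automaton $F$ on $A^{\mathbb{Z}^2}$, $$\limsup_{n\to\infty}\frac{h(\mathcal{S}_n,F)}{n}\le 8\cdot\liminf_{n\to\infty}\frac{h(\mathcal{S}_n,F)}{n}.$$
   Context: $A^{\mathbb{Z}^2}$ carries the product of discrete topologies. The shifts are $\sigma^v(x)_u=x_{u+v}$, $u,v\in\mathbb{Z}^2$. Let $E_n=\{(i,j)\in\mathbb{Z}^2: -n\le i,j\le n\}$. A cellular automaton (CA) $F$ is a continuous self-map of $A^{\mathbb{Z}^2}$ commuting with all shifts; equivalently there are $r\in\mathbb{N}$ and $f:A^{E_r}\to A$ with $F(x)_z=f\big((x_{z+u})_{u\in E_r}\big)$ for all $z$; such an $r$ is called the radius of $F$. For $n\ge r$, $E'_n=E_n\setminus E_{n-r}$ (with $r$ the radius of the CA under consideration). For a finite open cover $\mathcal{C}$, $\mathcal{C}'_n=\bigvee_{v\in E'_n}\sigma^v(\mathcal{C})$. $\mathcal{S}_n$ is the clopen partition (viewed as an open cover) according to the pattern $x|_{E_n}$. For an open cover $\mathcal{U}$, $H(\mathcal{U})=\ln N(\mathcal{U})$ with $N(\mathcal{U})$ the smallest cardinality of a subcover; $h(\mathcal{U},F)=\lim_{N\to\infty}\frac1N H(\bigvee_{i=0}^{N-1}F^{-i}\mathcal{U})$; $ER(\mathcal{C},F)=\limsup_{n\to\infty}\frac1n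 h(\mathcal{C}'_n,F)$; and $ER(A^{\mathbb{Z}^2},F)=\sup_{\mathcal{C}}ER(\mathcal{C},F)$ over all finite open covers $\mathcal{C}$. *)

theory Defs
  imports "HOL-Analysis.Analysis"
begin

section \<open>Configurations and cellular automata\<close>

type_synonym 'a config = "int \<times> int \<Rightarrow> 'a"

definition config_topology :: "'a config topology" where
  "config_topology = product_topology (\<lambda>_. discrete_topology UNIV) UNIV"

definition shift :: "int \<times> int \<Rightarrow> 'a config \<Rightarrow> 'a config" where
  "shift v x = (\<lambda>u. x (u + v))"

definition E :: "nat \<Rightarrow> (int \<times> int) set" where
  "E n = {- int n..int n} \<times> {- int n..int n}"

definition cellular_automaton :: "('a config \<Rightarrow> 'a config) \<Rightarrow> bool" where
  "cellular_automaton F \<longleftrightarrow>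
     continuous_map config_topology config_topology F \<and>
     (\<forall>v x. F (shift v x) = shift v (F x))"

text \<open>
  A radius is not unique: every number above a radius is again a radius. The local rule \<open>f\<close>
  only sees the pattern on \<open>E r\<close>, since its argument is cut off by \<open>restrict\<close>.
\<close>
definition has_radius :: "('a config \<Rightarrow> 'a config) \<Rightarrow> nat \<Rightarrow> bool" where
  "has_radius F r \<longleftrightarrow> (\<exists>f. \<forall>x z. F x z = f (restrict (\<lambda>u. x (z + u)) (E r)))"


section \<open>Open covers and their entropy\<close>

text \<open>In this section the space is the whole type \<open>'x\<close>.\<close>

definition covers :: "'x set set \<Rightarrow> bool" where
  "covers U \<longleftrightarrow> \<Union>U = UNIV"

text \<open>The join over the empty index set is the trivial cover \<open>{UNIV}\<close>.\<close>
definition join :: "'i set \<Rightarrow> ('i \<Rightarrow> 'x set set) \<Rightarrow> 'x set set" where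
  "join I C = (\<lambda>U. \<Inter>i\<in>I. U i) ` (\<Pi>\<^sub>E i\<in>I. C i)"

definition min_subcover :: "'x set set \<Rightarrow> nat" where
  "min_subcover U = (LEAST m. \<exists>V\<subseteq>U. finite V \<and> covers V \<and> card V = m)"

definition H :: "'x set set \<Rightarrow> real" where
  "H U = ln (real (min_subcover U))"

definition preimage_cover :: "('x \<Rightarrow> 'x) \<Rightarrow> 'x set set \<Rightarrow> 'x set set" where
  "preimage_cover G U = (\<lambda>S. G -` S) ` U"

definition cover_entropy :: "'x set set \<Rightarrow> ('x \<Rightarrow> 'x) \<Rightarrow> real" where
  "cover_entropy U F =
     lim (\<lambda>N. H (join {..<N} (\<lambda>i. preimage_cover (F ^^ i) U)) / real N)"


section \<open>Entropy rate\<close>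

definition finite_open_cover :: "'a config set set \<Rightarrow> bool" where
  "finite_open_cover C \<longleftrightarrow>
     finite C \<and> (\<forall>S\<in>C. openin config_topology S) \<and> covers C"

text \<open>
  The frame is meant for \<open>n \<ge> r\<close>. For \<open>n < r\<close> the subtraction on \<open>nat\<close> truncates, which has no
  influence on the limit superior below.
\<close>
definition frame :: "nat \<Rightarrow> nat \<Rightarrow> (int \<times> int) set" where
  "frame r n = E n - E (n - r)"

definition frame_cover :: "nat \<Rightarrow> 'a config set set \<Rightarrow> nat \<Rightarrow> 'a config set set" where
  "frame_cover r C n = join (frame r n) (\<lambda>v. (\<lambda>S. shift v ` S) ` C)"

definition pattern_partition :: "nat \<Rightarrow> 'a config set set" where
  "pattern_partition n = range (\<lambda>x. {y. \<forall>u\<in>E n. y u = x u})"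

text \<open>The first argument \<open>r\<close> is the radius of \<open>F\<close> used to form the frames.\<close>
definition ER_cover :: "nat \<Rightarrow> 'a config set set \<Rightarrow> ('a config \<Rightarrow> 'a config) \<Rightarrow> ereal" where
  "ER_cover r C F = limsup (\<lambda>n. ereal (cover_entropy (frame_cover r C n) F / real n))"

definition ER :: "nat \<Rightarrow> ('a config \<Rightarrow> 'a config) \<Rightarrow> ereal" where
  "ER r F = (SUP C \<in> Collect finite_open_cover. ER_cover r C F)"

end

theory Submission imports Defs begin

text \<open>
  For every radius \<open>r\<close> of \<open>F\<close>, the number \<open>ER r F\<close> is the upper growth rate of the entropies
  \<open>h(S\<^sub>n, F)\<close>. It is at most this rate because, by compactness, every finite open cover is
  refined by some \<open>S\<^sub>m\<close>. It is at least this rate because the history of the frame, together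
  with the initial pattern, determines the history of the square that it encloses, so that
  frame and square have the same entropy. Part (i) then follows from
  \<open>h(S\<^sub>n, F\<^sup>k) \<le> k h(S\<^sub>n, F) \<le> h(S\<^bsub>n+kr\<^esub>, F\<^sup>k)\<close>. For part (ii), the frame of \<open>E n\<close> is covered
  by about \<open>8 n / m\<close> translates of \<open>E m\<close>, each of which contributes at most \<open>h(S\<^sub>m, F)\<close>.
\<close>

section \<open>Entropy of finite covers\<close>

text \<open>Fekete's subadditivity argument: the limit is the infimum of the quotients over
  \<open>n \<ge> 1\<close>. Dividing \<open>n\<close> by a nearly optimal \<open>m\<close> bounds
  \<open>a n / n\<close> by \<open>a m / m\<close> plus a remainder term of order
  \<open>1 / n\<close>.\<close>

lemma fekete_convergent:
  fixes a :: "nat \<Rightarrow> real"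
  assumes sub: "\<And>m n. a (m + n) \<le> a m + a n" and nonneg: "\<And>n. 0 \<le> a n"
  shows "convergent (\<lambda>n. a n / real n)"
proof -
  define L where "L = Inf ((\<lambda>n. a n / real n) ` {1..})"
  have bdd: "bdd_below ((\<lambda>n. a n / real n) ` {1..})"
    by (rule bdd_belowI[of _ 0]) (use nonneg in auto)
  have lower: "L \<le> a n / real n" if "n \<ge> 1" for n
    unfolding L_def by (rule cInf_lower[OF _ bdd]) (use that in auto)
  have mult: "a (q * m + s) \<le> real q * a m + a s" for q m s
  proof (induction q)
    case (Suc q)
    have "a (Suc q * m + s) = a (m + (q * m + s))" by (simp add: algebra_simps)
    also have "\<dots> \<le> a m + a (q * m + s)" by (rule sub)
    finally show ?case using Suc by (simp add: algebra_simps)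
  qed simp
  have "(\<lambda>n. a n / real n) \<longlonglongrightarrow> L"
  proof (rule LIMSEQ_I)
    fix e :: real assume "e > 0"
    have "Inf ((\<lambda>n. a n / real n) ` {1..}) < L + e / 2" using \<open>e > 0\<close> unfolding L_def by simp
    then obtain m where m: "m \<ge> 1" "a m / real m < L + e / 2"
      using cInf_lessD[of "(\<lambda>n. a n / real n) ` {1..}"] by auto
    \<comment> \<open>\<open>B\<close> bounds the contribution of every remainder modulo
      \<open>m\<close>; \<open>n0\<close> below is chosen so that \<open>B / n\<close> falls under
      \<open>e / 2\<close>.\<close>
    define B where "B = Max (a ` {..<m})"
    have B: "a s \<le> B" if "s < m" for s
      unfolding B_def by (rule Max_ge) (use that in auto)
    obtain n0 :: nat where n0: "real n0 > 2 * B / e" using reals_Archimedean2 by blast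
    show "\<exists>no. \<forall>n\<ge>no. norm (a n / real n - L) < e"
    proof (intro exI allI impI)
      fix n assume n: "n \<ge> max 1 n0"
      then have pos: "real n > 0" by simp
      have "a n \<le> real (n div m) * a m + a (n mod m)"
        using mult[of "n div m" m "n mod m"] by simp
      moreover have "a (n mod m) \<le> B" using B m by simp
      moreover have "real (n div m) * a m \<le> (real n / real m) * a m"
        by (rule mult_right_mono[OF of_nat_div_le_of_nat nonneg])
      ultimately have "a n \<le> real n * (a m / real m) + B" by simp
      then have "a n / real n \<le> a m / real m + B / real n"
        using pos by (simp add: field_simps)
      moreover have "B / real n < e / 2"
      proof -
        have "2 * B / e < real n" using n n0 by linarith
        then show ?thesis using pos \<open>e > 0\<close> by (simp add: field_simps)
      qed
      ultimately have "a n / real n < L + e" using m by linarith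
      moreover have "L \<le> a n / real n" using lower n by simp
      ultimately show "norm (a n / real n - L) < e" by simp
    qed
  qed
  then show ?thesis by (rule convergentI)
qed

section \<open>Refinement, joins and minimal subcovers\<close>

definition cover_refines :: "'x set set \<Rightarrow> 'x set set \<Rightarrow> bool" where
  "cover_refines U V \<longleftrightarrow> (\<forall>A\<in>U. \<exists>B\<in>V. A \<subseteq> B)"

text \<open>This names the join inside \<open>cover_entropy\<close>, so that its growth in
  \<open>N\<close> can be treated as a sequence.\<close>

definition iterate_cover :: "('x \<Rightarrow> 'x) \<Rightarrow> 'x set set \<Rightarrow> nat \<Rightarrow> 'x set set" where
  "iterate_cover F U N = join {..<N} (\<lambda>i. preimage_cover (F ^^ i) U)"

lemma join_memI: "(\<And>i. i \<in> I \<Longrightarrow> U i \<in> C i) \<Longrightarrow> (\<Inter>i\<in>I. U i) \<in> join I C"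
  unfolding join_def by (rule image_eqI[of _ _ "restrict U I"]) auto

lemma join_memE:
  assumes "X \<in> join I C"
  obtains U where "\<And>i. i \<in> I \<Longrightarrow> U i \<in> C i" "X = (\<Inter>i\<in>I. U i)"
  using assms unfolding join_def by auto

lemma finite_join: "finite I \<Longrightarrow> (\<And>i. i \<in> I \<Longrightarrow> finite (C i)) \<Longrightarrow> finite (join I C)"
  unfolding join_def by (intro finite_imageI finite_PiE)

lemma coversD: "covers U \<Longrightarrow> \<exists>A\<in>U. x \<in> A"
  unfolding covers_def by blast

lemma coversI: "(\<And>x. \<exists>A\<in>U. x \<in> A) \<Longrightarrow> covers U"
  unfolding covers_def by blast

lemma covers_join:
  assumes "\<And>i. i \<in> I \<Longrightarrow> covers (C i)"
  shows "covers (join I C)"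
proof (rule coversI)
  fix x
  have "\<forall>i\<in>I. \<exists>A. A \<in> C i \<and> x \<in> A" using assms coversD by fast
  then obtain U where "\<forall>i\<in>I. U i \<in> C i \<and> x \<in> U i" by metis
  then show "\<exists>A\<in>join I C. x \<in> A" by (intro bexI[OF _ join_memI[of I U]]) auto
qed

lemma cover_refines_join:
  assumes "\<And>i. i \<in> I \<Longrightarrow> cover_refines (C i) (D i)"
  shows "cover_refines (join I C) (join I D)"
  unfolding cover_refines_def
proof
  fix X assume "X \<in> join I C"
  then obtain U where U: "\<And>i. i \<in> I \<Longrightarrow> U i \<in> C i" "X = (\<Inter>i\<in>I. U i)" by (rule join_memE) blast
  have "\<forall>i\<in>I. \<exists>B. B \<in> D i \<and> U i \<subseteq> B" using assms U unfolding cover_refines_def by blast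
  then obtain V where "\<forall>i\<in>I. V i \<in> D i \<and> U i \<subseteq> V i" by metis
  then show "\<exists>B\<in>join I D. X \<subseteq> B" using U by (intro bexI[OF _ join_memI[of I V]]) auto
qed

lemma finite_preimage_cover: "finite U \<Longrightarrow> finite (preimage_cover G U)"
  unfolding preimage_cover_def by simp

lemma covers_preimage_cover: "covers U \<Longrightarrow> covers (preimage_cover G U)"
  by (rule coversI) (auto simp: preimage_cover_def dest: coversD)

lemma cover_refines_preimage_cover:
  "cover_refines U V \<Longrightarrow> cover_refines (preimage_cover G U) (preimage_cover G V)"
  unfolding preimage_cover_def cover_refines_def by simp (meson vimage_mono)

lemma finite_iterate_cover: "finite U \<Longrightarrow> finite (iterate_cover F U N)"
  unfolding iterate_cover_def by (intro finite_join finite_preimage_cover) auto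

lemma covers_iterate_cover: "covers U \<Longrightarrow> covers (iterate_cover F U N)"
  unfolding iterate_cover_def by (intro covers_join covers_preimage_cover)

text \<open>Replacing each member of \<open>W\<close> by a member of \<open>V\<close> containing it
  yields a subcover of \<open>V\<close>. All upper bounds on \<open>min_subcover\<close> come from
  this, since \<open>W\<close> need not consist of members of \<open>V\<close>.\<close>

lemma min_subcover_le:
  assumes "finite W" "covers W" "cover_refines W V"
  shows "min_subcover V \<le> card W"
proof -
  obtain g where g: "\<forall>A\<in>W. g A \<in> V \<and> A \<subseteq> g A"
    using assms(3) unfolding cover_refines_def by metis
  have "covers (g ` W)"
  proof (rule coversI)
    fix x
    obtain A where "A \<in> W" "x \<in> A" using coversD[OF assms(2), of x] by blast
    then show "\<exists>X\<in>g ` W. x \<in> X" using g by (intro bexI[of _ "g A"]) auto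
  qed
  then have "min_subcover V \<le> card (g ` W)"
    unfolding min_subcover_def using assms(1) g by (intro Least_le exI[of _ "g ` W"]) auto
  also have "\<dots> \<le> card W" by (rule card_image_le[OF assms(1)])
  finally show ?thesis .
qed

lemma min_subcover_obtain:
  assumes "finite U" "covers U"
  obtains W where "W \<subseteq> U" "finite W" "covers W" "card W = min_subcover U"
proof -
  have "\<exists>V\<subseteq>U. finite V \<and> covers V \<and> card V = min_subcover U"
    unfolding min_subcover_def by (rule LeastI_ex, intro exI[of _ "card U"] exI[of _ U]) (use assms in auto)
  then show ?thesis using that by blast
qed

lemma min_subcover_pos:
  assumes "finite U" "covers U"
  shows "0 < min_subcover U"
proof -
  obtain W where W: "W \<subseteq> U" "finite W" "covers W" "card W = min_subcover U"
    by (rule min_subcover_obtain[OF assms])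
  \<comment> \<open>A type is inhabited, so the empty family does not cover it.\<close>
  then have "W \<noteq> {}" unfolding covers_def by auto
  then show ?thesis using W card_gt_0_iff by metis
qed

lemma min_subcover_mono:
  assumes "finite U" "covers U" "cover_refines U V"
  shows "min_subcover V \<le> min_subcover U"
proof -
  obtain W where W: "W \<subseteq> U" "finite W" "covers W" "card W = min_subcover U"
    by (rule min_subcover_obtain[OF assms(1,2)])
  moreover have "cover_refines W V" using assms(3) W(1) unfolding cover_refines_def by blast
  ultimately show ?thesis using min_subcover_le by metis
qed

text \<open>Preimages of a subcover cover again. If \<open>G\<close> is not surjective, fewer of
  them may suffice, hence only an inequality.\<close>

lemma min_subcover_preimage_cover:
  assumes "finite U" "covers U"
  shows "min_subcover (preimage_cover G U) \<le> min_subcover U"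
proof -
  obtain W where W: "W \<subseteq> U" "finite W" "covers W" "card W = min_subcover U"
    by (rule min_subcover_obtain[OF assms(1,2)])
  have "min_subcover (preimage_cover G U) \<le> card (preimage_cover G W)"
  proof (rule min_subcover_le)
    show "cover_refines (preimage_cover G W) (preimage_cover G U)"
      using W(1) by (intro cover_refines_preimage_cover) (auto simp: cover_refines_def)
  qed (use W finite_preimage_cover covers_preimage_cover in auto)
  also have "\<dots> \<le> card W" unfolding preimage_cover_def using W(2) by (rule card_image_le)
  finally show ?thesis using W by simp
qed

text \<open>Pairwise intersections of two minimal subcovers cover the space and refine the joint
  join.\<close>

lemma min_subcover_join_Un:
  assumes "finite (join I C)" "covers (join I C)" "finite (join J C)" "covers (join J C)"
  shows "min_subcover (join (I \<union> J) C) \<le> min_subcover (join I C) * min_subcover (join J C)"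
proof -
  obtain W where W: "W \<subseteq> join I C" "finite W" "covers W" "card W = min_subcover (join I C)"
    by (rule min_subcover_obtain[OF assms(1,2)])
  obtain W' where W': "W' \<subseteq> join J C" "finite W'" "covers W'" "card W' = min_subcover (join J C)"
    by (rule min_subcover_obtain[OF assms(3,4)])
  let ?Z = "(\<lambda>(A, B). A \<inter> B) ` (W \<times> W')"
  have "min_subcover (join (I \<union> J) C) \<le> card ?Z"
  proof (rule min_subcover_le)
    show "finite ?Z" using W W' by simp
    show "covers ?Z"
    proof (rule coversI)
      fix x
      obtain A B where "A \<in> W" "x \<in> A" "B \<in> W'" "x \<in> B"
        using coversD[OF W(3), of x] coversD[OF W'(3), of x] by blast
      then show "\<exists>X\<in>?Z. x \<in> X" by (intro bexI[of _ "A \<inter> B"]) auto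
    qed
    show "cover_refines ?Z (join (I \<union> J) C)"
      unfolding cover_refines_def
    proof
      fix X assume "X \<in> ?Z"
      then obtain A B where X: "X = A \<inter> B" "A \<in> join I C" "B \<in> join J C" using W(1) W'(1) by auto
      obtain U where U: "\<And>i. i \<in> I \<Longrightarrow> U i \<in> C i" "A = (\<Inter>i\<in>I. U i)" using X(2) by (rule join_memE) blast
      obtain V where V: "\<And>i. i \<in> J \<Longrightarrow> V i \<in> C i" "B = (\<Inter>i\<in>J. V i)" using X(3) by (rule join_memE) blast
      \<comment> \<open>On indices common to \<open>I\<close> and \<open>J\<close> only the choice
        \<open>U\<close> is kept. This can only enlarge the intersection, which refinement
        permits.\<close>
      let ?T = "\<lambda>i. if i \<in> I then U i else V i"
      have "(\<Inter>i\<in>I\<union>J. ?T i) \<in> join (I \<union> J) C" by (rule join_memI) (use U V in auto)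
      moreover have "X \<subseteq> (\<Inter>i\<in>I\<union>J. ?T i)" using X U V by auto
      ultimately show "\<exists>B\<in>join (I \<union> J) C. X \<subseteq> B" by blast
    qed
  qed
  also have "\<dots> \<le> card (W \<times> W')" using W W' by (intro card_image_le) simp
  finally show ?thesis using W W' by (simp add: card_cartesian_product)
qed

text \<open>The steps from \<open>m\<close> to \<open>m + n\<close> are the first \<open>n\<close>
  steps seen through \<open>F ^^ m\<close>, and passing to preimages does not increase the minimal
  subcover. After taking logarithms this is the subadditivity needed for Fekete.\<close>

lemma min_subcover_iterate_cover_add:
  assumes "finite U" "covers U"
  shows "min_subcover (iterate_cover F U (m + n))
         \<le> min_subcover (iterate_cover F U m) * min_subcover (iterate_cover F U n)"
proof -
  let ?C = "\<lambda>i. preimage_cover (F ^^ i) U"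
  let ?P = "preimage_cover (F ^^ m) (iterate_cover F U n)"
  have fin: "finite (join I ?C)" if "finite I" for I
    using that assms by (intro finite_join finite_preimage_cover)
  have cov: "covers (join I ?C)" for I using assms by (intro covers_join covers_preimage_cover)
  have "cover_refines ?P (join {m..<m + n} ?C)"
    unfolding cover_refines_def
  proof
    fix X assume "X \<in> ?P"
    then obtain Y where Y: "Y \<in> iterate_cover F U n" "X = (F ^^ m) -` Y"
      unfolding preimage_cover_def by blast
    obtain V where V: "\<And>i. i \<in> {..<n} \<Longrightarrow> V i \<in> ?C i" "Y = (\<Inter>i\<in>{..<n}. V i)"
      using Y(1) unfolding iterate_cover_def by (rule join_memE) blast
    have "(\<Inter>j\<in>{m..<m + n}. (F ^^ m) -` V (j - m)) \<in> join {m..<m + n} ?C"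
    proof (rule join_memI)
      fix j assume j: "j \<in> {m..<m + n}"
      then have "V (j - m) \<in> ?C (j - m)" using V(1) by auto
      then obtain S where S: "S \<in> U" "V (j - m) = (F ^^ (j - m)) -` S"
        unfolding preimage_cover_def by blast
      have "F ^^ j = F ^^ (j - m) \<circ> F ^^ m" using j by (simp flip: funpow_add)
      then have "(F ^^ m) -` V (j - m) = (F ^^ j) -` S" using S by (simp add: vimage_comp)
      then show "(F ^^ m) -` V (j - m) \<in> ?C j" using S unfolding preimage_cover_def by blast
    qed
    moreover have "X \<subseteq> (\<Inter>j\<in>{m..<m + n}. (F ^^ m) -` V (j - m))" using Y V by auto
    ultimately show "\<exists>B\<in>join {m..<m + n} ?C. X \<subseteq> B" by blast
  qed
  then have "min_subcover (join {m..<m + n} ?C) \<le> min_subcover ?P"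
    using assms by (intro min_subcover_mono finite_preimage_cover covers_preimage_cover
        finite_iterate_cover covers_iterate_cover)
  also have "\<dots> \<le> min_subcover (iterate_cover F U n)"
    using assms by (intro min_subcover_preimage_cover finite_iterate_cover covers_iterate_cover)
  finally have shifted: "min_subcover (join {m..<m + n} ?C) \<le> min_subcover (iterate_cover F U n)" .
  have "{..<m + n} = {..<m} \<union> {m..<m + n}" by auto
  then have "min_subcover (iterate_cover F U (m + n))
      \<le> min_subcover (iterate_cover F U m) * min_subcover (join {m..<m + n} ?C)"
    unfolding iterate_cover_def using min_subcover_join_Un[of "{..<m}" ?C "{m..<m + n}"] fin cov
    by simp
  also have "\<dots> \<le> min_subcover (iterate_cover F U m) * min_subcover (iterate_cover F U n)"
    using shifted by (rule mult_le_mono2)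
  finally show ?thesis .
qed

section \<open>Entropy of a cover as a genuine limit\<close>

lemma H_nonneg:
  assumes "finite U" "covers U"
  shows "0 \<le> H U"
  unfolding H_def using min_subcover_pos[OF assms] by simp

lemma H_mono:
  assumes "finite U" "covers U" "finite V" "covers V" "cover_refines U V"
  shows "H V \<le> H U"
  unfolding H_def using min_subcover_pos[OF assms(3,4)] min_subcover_mono[OF assms(1,2,5)]
  by simp

text \<open>The \<open>lim\<close> in \<open>cover_entropy\<close> is meaningful only once
  convergence is known; afterwards entropies are compared through these sequences alone.\<close>

lemma cover_entropy_LIMSEQ:
  assumes "finite U" "covers U"
  shows "(\<lambda>N. H (iterate_cover F U N) / real N) \<longlonglongrightarrow> cover_entropy U F"
proof -
  have pos: "0 < min_subcover (iterate_cover F U n)" for n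
    using assms by (intro min_subcover_pos finite_iterate_cover covers_iterate_cover)
  have "H (iterate_cover F U (m + n)) \<le> H (iterate_cover F U m) + H (iterate_cover F U n)" for m n
  proof -
    have "H (iterate_cover F U (m + n))
        \<le> ln (real (min_subcover (iterate_cover F U m) * min_subcover (iterate_cover F U n)))"
      unfolding H_def using pos[of "m + n"] pos[of m] pos[of n]
        min_subcover_iterate_cover_add[OF assms, of F m n]
      by (simp flip: of_nat_mult)
    then show ?thesis unfolding H_def using pos[of m] pos[of n] by (simp add: ln_mult)
  qed
  moreover have "0 \<le> H (iterate_cover F U n)" for n
    using assms by (intro H_nonneg finite_iterate_cover covers_iterate_cover)
  ultimately have "convergent (\<lambda>N. H (iterate_cover F U N) / real N)"
    by (rule fekete_convergent)
  then show ?thesis unfolding cover_entropy_def iterate_cover_def convergent_LIMSEQ_iff .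
qed

lemma cover_entropy_nonneg:
  assumes "finite U" "covers U"
  shows "0 \<le> cover_entropy U F"
proof -
  have "0 \<le> H (iterate_cover F U N) / real N" for N
    by (intro divide_nonneg_nonneg H_nonneg finite_iterate_cover covers_iterate_cover assms) simp
  then show ?thesis
    using LIMSEQ_le_const[OF cover_entropy_LIMSEQ[OF assms, of F], of 0] by blast
qed

lemma cover_entropy_mono:
  assumes "finite U" "covers U" "finite V" "covers V" "cover_refines U V"
  shows "cover_entropy V F \<le> cover_entropy U F"
proof -
  have "H (iterate_cover F V N) / real N \<le> H (iterate_cover F U N) / real N" for N
  proof -
    have "cover_refines (iterate_cover F U N) (iterate_cover F V N)"
      unfolding iterate_cover_def
      by (rule cover_refines_join) (rule cover_refines_preimage_cover[OF assms(5)])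
    then show ?thesis
      by (intro divide_right_mono H_mono finite_iterate_cover covers_iterate_cover assms) auto
  qed
  then show ?thesis
    using LIMSEQ_le[OF cover_entropy_LIMSEQ[OF assms(3,4), of F]
        cover_entropy_LIMSEQ[OF assms(1,2), of F]] by blast
qed

section \<open>Counting itineraries of partitions\<close>

text \<open>The partition into level sets, indexed by points in the same way as
  \<open>pattern_partition\<close>.\<close>

definition fibres :: "('x \<Rightarrow> 'b) \<Rightarrow> 'x set set" where
  "fibres \<phi> = range (\<lambda>x. {y. \<phi> y = \<phi> x})"

definition itinerary :: "('x \<Rightarrow> 'x) \<Rightarrow> ('x \<Rightarrow> 'b) \<Rightarrow> nat \<Rightarrow> 'x \<Rightarrow> nat \<Rightarrow> 'b" where
  "itinerary F \<phi> N x = restrict (\<lambda>i. \<phi> ((F ^^ i) x)) {..<N}"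

lemma restrict_eq_iff: "restrict f D = restrict g D \<longleftrightarrow> (\<forall>u\<in>D. f u = g u)"
  by (auto simp: restrict_def fun_eq_iff)

lemma itinerary_eq_iff:
  "itinerary F \<phi> N x = itinerary F \<phi> N y \<longleftrightarrow> (\<forall>i<N. \<phi> ((F ^^ i) x) = \<phi> ((F ^^ i) y))"
  unfolding itinerary_def restrict_eq_iff by auto

lemma finite_range_itinerary:
  assumes "finite (range \<phi>)"
  shows "finite (range (itinerary F \<phi> N))"
proof (rule finite_subset)
  show "range (itinerary F \<phi> N) \<subseteq> {..<N} \<rightarrow>\<^sub>E range \<phi>" unfolding itinerary_def by (intro image_subsetI) simp
  show "finite ({..<N} \<rightarrow>\<^sub>E range \<phi>)" using assms by (intro finite_PiE) auto
qed

lemma card_range_pos: "finite (range f) \<Longrightarrow> 0 < card (range f)"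
  by (simp add: card_gt_0_iff)

text \<open>If \<open>g\<close> determines \<open>f\<close>, then \<open>range f\<close> is an image
  of \<open>range g\<close>. Most counting bounds below say that one observation determines
  another.\<close>

lemma card_range_le:
  assumes "finite (range g)" "\<And>x y. g x = g y \<Longrightarrow> f x = f y"
  shows "card (range f) \<le> card (range g)"
proof -
  have "f x = f (inv g (g x))" for x by (rule assms(2)) (simp add: f_inv_into_f)
  then have "range f \<subseteq> (\<lambda>p. f (inv g p)) ` range g"
    by (intro image_subsetI image_eqI[OF _ rangeI])
  then show ?thesis using assms(1) by (rule surj_card_le[rotated])
qed

lemma card_range_le_prod:
  fixes f :: "'x \<Rightarrow> 'b" and g :: "'i \<Rightarrow> 'x \<Rightarrow> 'c"
  assumes "finite K" "\<And>i. i \<in> K \<Longrightarrow> finite (range (g i))"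
    and "\<And>x y. (\<And>i. i \<in> K \<Longrightarrow> g i x = g i y) \<Longrightarrow> f x = f y"
  shows "card (range f) \<le> (\<Prod>i\<in>K. card (range (g i)))"
proof -
  let ?G = "\<lambda>x. restrict (\<lambda>i. g i x) K"
  have sub: "range ?G \<subseteq> (\<Pi>\<^sub>E i\<in>K. range (g i))" by auto
  have fin: "finite (\<Pi>\<^sub>E i\<in>K. range (g i))" by (rule finite_PiE[OF assms(1,2)])
  have "card (range f) \<le> card (range ?G)"
    by (rule card_range_le[OF finite_subset[OF sub fin]], rule assms(3)) (simp only: restrict_eq_iff)
  also have "\<dots> \<le> card (\<Pi>\<^sub>E i\<in>K. range (g i))" by (rule card_mono[OF fin sub])
  finally show ?thesis using assms(1) by (simp add: card_PiE)
qed

text \<open>One sample value per member exhausts the range; an empty member merely contributes an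
  arbitrary value.\<close>

lemma card_range_le_card_cover:
  assumes "finite W" "covers W" "\<And>A x y. A \<in> W \<Longrightarrow> x \<in> A \<Longrightarrow> y \<in> A \<Longrightarrow> f x = f y"
  shows "card (range f) \<le> card W"
proof -
  have "range f \<subseteq> (\<lambda>A. f (SOME x. x \<in> A)) ` W"
  proof
    fix p assume "p \<in> range f"
    then obtain x where p: "p = f x" by auto
    obtain A where A: "A \<in> W" "x \<in> A" using coversD[OF assms(2), of x] by auto
    have "(SOME x. x \<in> A) \<in> A" using A(2) by (rule someI)
    then have "p = f (SOME x. x \<in> A)" unfolding p using assms(3) A by metis
    then show "p \<in> (\<lambda>A. f (SOME x. x \<in> A)) ` W" using A(1) by (rule image_eqI)
  qed
  then show ?thesis using assms(1) by (rule surj_card_le[rotated])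
qed

lemma covers_fibres: "covers (fibres \<phi>)"
  unfolding fibres_def by (rule coversI) auto

lemma fibres_eq_image: "fibres \<phi> = (\<lambda>p. {y. \<phi> y = p}) ` range \<phi>"
  unfolding fibres_def by auto

lemma finite_fibres: "finite (range \<phi>) \<Longrightarrow> finite (fibres \<phi>)"
  unfolding fibres_eq_image by (rule finite_imageI)

lemma iterate_cover_fibres_cong:
  assumes "A \<in> iterate_cover F (fibres \<phi>) N" "x \<in> A" "y \<in> A"
  shows "itinerary F \<phi> N x = itinerary F \<phi> N y"
proof -
  obtain U where U: "\<And>i. i \<in> {..<N} \<Longrightarrow> U i \<in> preimage_cover (F ^^ i) (fibres \<phi>)"
    "A = (\<Inter>i\<in>{..<N}. U i)"
    using assms(1) unfolding iterate_cover_def by (rule join_memE) auto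
  have "\<phi> ((F ^^ i) x) = \<phi> ((F ^^ i) y)" if "i < N" for i
  proof -
    have "x \<in> U i" "y \<in> U i" using assms(2,3) that unfolding U(2) by auto
    then show ?thesis using U(1)[of i] that unfolding preimage_cover_def fibres_def by auto
  qed
  then show ?thesis by (simp add: itinerary_eq_iff)
qed

text \<open>For a partition, covering numbers become counts of itineraries. The level sets of the
  itinerary refine the iterated cover; conversely each member of a subcover carries at most one
  itinerary, so every itinerary needs its own member.\<close>

lemma min_subcover_iterate_cover_fibres:
  assumes "finite (range \<phi>)"
  shows "min_subcover (iterate_cover F (fibres \<phi>) N) = card (range (itinerary F \<phi> N))"
proof (rule antisym)
  have fin: "finite (range (itinerary F \<phi> N))" by (rule finite_range_itinerary[OF assms])
  have "cover_refines (fibres (itinerary F \<phi> N)) (iterate_cover F (fibres \<phi>) N)"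
    unfolding cover_refines_def
  proof
    fix A assume "A \<in> fibres (itinerary F \<phi> N)"
    then obtain x where A: "A = {y. itinerary F \<phi> N y = itinerary F \<phi> N x}"
      unfolding fibres_def by auto
    have "(\<Inter>i\<in>{..<N}. (F ^^ i) -` {y. \<phi> y = \<phi> ((F ^^ i) x)}) \<in> iterate_cover F (fibres \<phi>) N"
      unfolding iterate_cover_def unfolding preimage_cover_def fibres_def
      by (rule join_memI, rule image_eqI[OF refl], rule image_eqI[OF refl]) simp
    moreover have "A \<subseteq> (\<Inter>i\<in>{..<N}. (F ^^ i) -` {y. \<phi> y = \<phi> ((F ^^ i) x)})"
      unfolding A by (auto simp: itinerary_eq_iff)
    ultimately show "\<exists>B\<in>iterate_cover F (fibres \<phi>) N. A \<subseteq> B" by (rule bexI[rotated])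
  qed
  then have "min_subcover (iterate_cover F (fibres \<phi>) N) \<le> card (fibres (itinerary F \<phi> N))"
    by (intro min_subcover_le finite_fibres fin covers_fibres)
  also have "\<dots> \<le> card (range (itinerary F \<phi> N))"
    unfolding fibres_eq_image by (rule card_image_le[OF fin])
  finally show "min_subcover (iterate_cover F (fibres \<phi>) N) \<le> card (range (itinerary F \<phi> N))" .
next
  have "finite (iterate_cover F (fibres \<phi>) N)" "covers (iterate_cover F (fibres \<phi>) N)"
    by (intro finite_iterate_cover covers_iterate_cover finite_fibres covers_fibres assms)+
  then obtain W where W: "W \<subseteq> iterate_cover F (fibres \<phi>) N" "finite W" "covers W"
    "card W = min_subcover (iterate_cover F (fibres \<phi>) N)"
    by (rule min_subcover_obtain)
  have "card (range (itinerary F \<phi> N)) \<le> card W"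
  proof (rule card_range_le_card_cover[OF W(2,3)])
    fix A x y assume "A \<in> W" "x \<in> A" "y \<in> A"
    then show "itinerary F \<phi> N x = itinerary F \<phi> N y"
      using W(1) by (intro iterate_cover_fibres_cong[of A]) auto
  qed
  then show "card (range (itinerary F \<phi> N)) \<le> min_subcover (iterate_cover F (fibres \<phi>) N)"
    using W(4) by simp
qed

lemma entropy_fibres_LIMSEQ:
  assumes "finite (range \<phi>)"
  shows "(\<lambda>N. ln (real (card (range (itinerary F \<phi> N)))) / real N)
           \<longlonglongrightarrow> cover_entropy (fibres \<phi>) F"
  using cover_entropy_LIMSEQ[OF finite_fibres[OF assms] covers_fibres[of \<phi>], of F]
  unfolding H_def min_subcover_iterate_cover_fibres[OF assms] .

text \<open>The ratio \<open>(n + m) / n\<close> tends to 1. Hence enlarging boxes by a constant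
  margin does not change the growth rate.\<close>

lemma limsup_shift_div:
  fixes a :: "nat \<Rightarrow> real"
  shows "limsup (\<lambda>n. ereal (a (n + m) / real n)) = limsup (\<lambda>n. ereal (a n / real n))"
proof -
  have "limsup (\<lambda>n. ereal (a (n + m) / real n))
      = limsup (\<lambda>n. ereal (real (n + m) / real n) * ereal (a (n + m) / real (n + m)))"
    by (intro Limsup_eq eventually_mono[OF eventually_gt_at_top[of 0]]) auto
  also have "\<dots> = ereal 1 * limsup (\<lambda>n. ereal (a (n + m) / real (n + m)))"
  proof (rule ereal_limsup_lim_mult)
    have "(\<lambda>n. 1 + real m * (1 / real n)) \<longlonglongrightarrow> 1 + real m * 0"
      by (intro tendsto_intros lim_1_over_n)
    moreover have "eventually (\<lambda>n. 1 + real m * (1 / real n) = real (n + m) / real n) sequentially"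
      by (intro eventually_mono[OF eventually_gt_at_top[of 0]]) (auto simp: field_simps)
    ultimately show "(\<lambda>n. ereal (real (n + m) / real n)) \<longlonglongrightarrow> ereal 1"
      by (auto intro: Lim_transform_eventually)
  qed auto
  also have "\<dots> = limsup (\<lambda>n. ereal (a n / real n))"
    using limsup_shift_k[of "\<lambda>n. ereal (a n / real n)" m] by (simp add: one_ereal_def[symmetric])
  finally show ?thesis .
qed

section \<open>Patterns on boxes and their space-time traces\<close>

definition pat :: "(int \<times> int) set \<Rightarrow> 'a config \<Rightarrow> 'a config" where
  "pat D x = restrict x D"

lemma pat_eq_iff: "pat D x = pat D y \<longleftrightarrow> (\<forall>u\<in>D. x u = y u)"
  unfolding pat_def restrict_eq_iff ..

lemma finite_range_pat:
  fixes D :: "(int \<times> int) set"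
  assumes "finite D"
  shows "finite (range (pat D :: ('a::finite) config \<Rightarrow> 'a config))"
proof (rule finite_subset)
  show "range (pat D :: 'a config \<Rightarrow> 'a config) \<subseteq> D \<rightarrow>\<^sub>E UNIV" unfolding pat_def by auto
  show "finite (D \<rightarrow>\<^sub>E (UNIV :: 'a set))" using assms by (intro finite_PiE) auto
qed

lemma pattern_partition_eq: "pattern_partition n = fibres (pat (E n))"
  unfolding pattern_partition_def fibres_def pat_eq_iff ..

lemma mem_E: "(i, j) \<in> E n \<longleftrightarrow> \<bar>i\<bar> \<le> int n \<and> \<bar>j\<bar> \<le> int n"
  unfolding E_def by auto

lemma finite_E: "finite (E n)"
  unfolding E_def by simp

lemma E_mono: "m \<le> n \<Longrightarrow> E m \<subseteq> E n"
  by (auto simp: mem_E)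

lemma add_mem_E: "u \<in> E m \<Longrightarrow> v \<in> E n \<Longrightarrow> u + v \<in> E (m + n)"
  by (cases u; cases v) (auto simp: mem_E)

lemma uminus_mem_E: "- u \<in> E n \<longleftrightarrow> u \<in> E n"
  by (cases u) (auto simp: mem_E)

lemma finite_subset_E:
  assumes "finite D"
  shows "\<exists>m. D \<subseteq> E m"
  using assms
proof induction
  case (insert u D)
  obtain m where m: "D \<subseteq> E m" using insert by auto
  obtain i j where u: "u = (i, j)" by fastforce
  have "insert u D \<subseteq> E (m + nat (\<bar>i\<bar> + \<bar>j\<bar>))"
    using m E_mono[of m "m + nat (\<bar>i\<bar> + \<bar>j\<bar>)"] by (auto simp: u mem_E)
  then show ?case ..
qed simp

lemma finite_pattern_partition: "finite (pattern_partition n :: ('a::finite) config set set)"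
  unfolding pattern_partition_eq by (intro finite_fibres finite_range_pat finite_E)

lemma covers_pattern_partition: "covers (pattern_partition n)"
  unfolding pattern_partition_eq by (rule covers_fibres)

text \<open>The number of space-time patterns over \<open>D\<close> of duration \<open>N\<close>;
  for \<open>D = E n\<close> its exponential rate in \<open>N\<close> is the entropy of
  \<open>pattern_partition n\<close>.\<close>

definition trace_count :: "('a config \<Rightarrow> 'a config) \<Rightarrow> (int \<times> int) set \<Rightarrow> nat \<Rightarrow> nat" where
  "trace_count F D N = card (range (itinerary F (pat D) N))"

lemma itinerary_pat_eq_iff:
  "itinerary F (pat D) N x = itinerary F (pat D) N y
    \<longleftrightarrow> (\<forall>i<N. \<forall>u\<in>D. (F ^^ i) x u = (F ^^ i) y u)"
  unfolding itinerary_eq_iff pat_eq_iff ..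

lemma finite_range_itinerary_pat:
  "finite D \<Longrightarrow> finite (range (itinerary F (pat D :: ('a::finite) config \<Rightarrow> 'a config) N))"
  by (intro finite_range_itinerary finite_range_pat)

lemma trace_count_pos:
  "finite D \<Longrightarrow> 0 < trace_count (F :: ('a::finite) config \<Rightarrow> 'a config) D N"
  unfolding trace_count_def by (intro card_range_pos finite_range_itinerary_pat)

lemma pattern_entropy_LIMSEQ:
  fixes F :: "('a::finite) config \<Rightarrow> 'a config"
  shows "(\<lambda>N. ln (real (trace_count F (E n) N)) / real N)
           \<longlonglongrightarrow> cover_entropy (pattern_partition n) F"
  unfolding pattern_partition_eq trace_count_def
  by (intro entropy_fibres_LIMSEQ finite_range_pat finite_E)

section \<open>Finite propagation speed and powers of the automaton\<close>

lemma has_radius_cong: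
  assumes "has_radius F r" "\<forall>u\<in>E (n + r). x u = y u"
  shows "\<forall>u\<in>E n. F x u = F y u"
proof
  fix z assume z: "z \<in> E n"
  obtain f where f: "\<And>x z. F x z = f (restrict (\<lambda>u. x (z + u)) (E r))"
    using assms(1) unfolding has_radius_def by auto
  have "restrict (\<lambda>u. x (z + u)) (E r) = restrict (\<lambda>u. y (z + u)) (E r)"
    unfolding restrict_eq_iff using assms(2) add_mem_E[OF z] by auto
  then show "F x z = F y z" unfolding f by simp
qed

lemma has_radius_funpow_cong:
  assumes "has_radius F r" "\<forall>u\<in>E (n + k * r). x u = y u"
  shows "\<forall>u\<in>E n. (F ^^ k) x u = (F ^^ k) y u"
  using assms(2)
proof (induction k arbitrary: n)
  case (Suc k)
  have "\<forall>u\<in>E (n + r). (F ^^ k) x u = (F ^^ k) y u"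
    by (rule Suc.IH) (use Suc.prems in \<open>simp add: algebra_simps\<close>)
  then show ?case using has_radius_cong[OF assms(1)] by simp
qed simp

lemma has_radius_shift:
  assumes "has_radius F r"
  shows "F (shift v x) = shift v (F x)"
proof -
  obtain f where f: "\<And>x z. F x z = f (restrict (\<lambda>u. x (z + u)) (E r))"
    using assms unfolding has_radius_def by auto
  show ?thesis unfolding shift_def by (simp add: fun_eq_iff f algebra_simps)
qed

text \<open>The itinerary under \<open>F ^^ k\<close> samples the one under \<open>F\<close> at the
  multiples of \<open>k\<close> below \<open>k * N\<close>.\<close>

lemma trace_count_power_le:
  fixes F :: "('a::finite) config \<Rightarrow> 'a config"
  assumes "finite D" "k > 0"
  shows "trace_count (F ^^ k) D N \<le> trace_count F D (k * N)"
  unfolding trace_count_def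
proof (rule card_range_le[OF finite_range_itinerary_pat[OF assms(1)]])
  fix x y assume "itinerary F (pat D) (k * N) x = itinerary F (pat D) (k * N) y"
  then show "itinerary (F ^^ k) (pat D) N x = itinerary (F ^^ k) (pat D) N y"
    using assms(2) by (simp add: itinerary_pat_eq_iff funpow_mult)
qed

text \<open>The times skipped by \<open>F ^^ k\<close> are recovered from the last sampled time:
  fewer than \<open>k\<close> steps remain, and the margin \<open>k * r\<close> suffices for
  them.\<close>

lemma trace_count_le_power:
  fixes F :: "('a::finite) config \<Rightarrow> 'a config"
  assumes "has_radius F r" "k > 0"
  shows "trace_count F (E n) (k * N) \<le> trace_count (F ^^ k) (E (n + k * r)) N"
  unfolding trace_count_def
proof (rule card_range_le[OF finite_range_itinerary_pat[OF finite_E]])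
  fix x y
  assume xy: "itinerary (F ^^ k) (pat (E (n + k * r))) N x = itinerary (F ^^ k) (pat (E (n + k * r))) N y"
  have "\<forall>u\<in>E n. (F ^^ t) x u = (F ^^ t) y u" if "t < k * N" for t
  proof -
    \<comment> \<open>Time \<open>t\<close> splits into \<open>t div k\<close> steps of
      \<open>F ^^ k\<close> followed by \<open>t mod k\<close> steps of \<open>F\<close>.\<close>
    have F_t: "(F ^^ t) z = (F ^^ (t mod k)) (((F ^^ k) ^^ (t div k)) z)" for z
    proof -
      have "F ^^ t = F ^^ (t mod k + k * (t div k))" by simp
      then show ?thesis unfolding funpow_add funpow_mult by simp
    qed
    have "t div k < N" using that by (simp add: less_mult_imp_div_less mult.commute)
    moreover have "E (n + (t mod k) * r) \<subseteq> E (n + k * r)"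
      using assms(2) by (intro E_mono) (simp add: less_imp_le)
    ultimately have "\<forall>u\<in>E (n + (t mod k) * r).
        ((F ^^ k) ^^ (t div k)) x u = ((F ^^ k) ^^ (t div k)) y u"
      using xy unfolding itinerary_pat_eq_iff by auto
    then show ?thesis unfolding F_t by (rule has_radius_funpow_cong[OF assms(1)])
  qed
  then show "itinerary F (pat (E n)) (k * N) x = itinerary F (pat (E n)) (k * N) y"
    unfolding itinerary_pat_eq_iff by auto
qed

text \<open>Along the subsequence \<open>k * N\<close> the quotient by \<open>k * N\<close> has the
  same limit; dividing by \<open>N\<close> instead produces the factor \<open>k\<close>.\<close>

lemma pattern_entropy_LIMSEQ_mult:
  fixes F :: "('a::finite) config \<Rightarrow> 'a config"
  assumes "k > 0"
  shows "(\<lambda>N. ln (real (trace_count F (E n) (k * N))) / real N)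
           \<longlonglongrightarrow> real k * cover_entropy (pattern_partition n) F"
proof -
  have "strict_mono (\<lambda>N. k * N)" using assms by (auto intro: strict_monoI)
  from LIMSEQ_subseq_LIMSEQ[OF pattern_entropy_LIMSEQ[of F n] this]
  have "(\<lambda>N. real k * (ln (real (trace_count F (E n) (k * N))) / real (k * N)))
           \<longlonglongrightarrow> real k * cover_entropy (pattern_partition n) F"
    by (intro tendsto_mult tendsto_const) (simp add: o_def)
  then show ?thesis using assms by simp
qed

lemma ln_trace_count_le:
  fixes F G :: "('a::finite) config \<Rightarrow> 'a config"
  assumes "finite D" "trace_count F D M \<le> trace_count G D' N"
  shows "ln (real (trace_count F D M)) \<le> ln (real (trace_count G D' N))"
  using trace_count_pos[OF assms(1), of F M] assms(2) by simp

lemma pattern_entropy_power_le: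
  fixes F :: "('a::finite) config \<Rightarrow> 'a config"
  assumes "k > 0"
  shows "cover_entropy (pattern_partition n) (F ^^ k) \<le> real k * cover_entropy (pattern_partition n) F"
proof -
  have "ln (real (trace_count (F ^^ k) (E n) N)) / real N
      \<le> ln (real (trace_count F (E n) (k * N))) / real N" for N
    by (intro divide_right_mono ln_trace_count_le trace_count_power_le finite_E assms) simp
  then show ?thesis
    using LIMSEQ_le[OF pattern_entropy_LIMSEQ[of "F ^^ k" n] pattern_entropy_LIMSEQ_mult[OF assms, of F n]]
    by blast
qed

lemma pattern_entropy_le_power:
  fixes F :: "('a::finite) config \<Rightarrow> 'a config"
  assumes "has_radius F r" "k > 0"
  shows "real k * cover_entropy (pattern_partition n) F
    \<le> cover_entropy (pattern_partition (n + k * r)) (F ^^ k)"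
proof -
  have "ln (real (trace_count F (E n) (k * N))) / real N
      \<le> ln (real (trace_count (F ^^ k) (E (n + k * r)) N)) / real N" for N
    by (intro divide_right_mono ln_trace_count_le trace_count_le_power finite_E assms) simp
  then show ?thesis
    using LIMSEQ_le[OF pattern_entropy_LIMSEQ_mult[OF assms(2), of F n]
        pattern_entropy_LIMSEQ[of "F ^^ k" "n + k * r"]]
    by blast
qed

text \<open>No radius enters here. Once \<open>ER\<close> is identified with this quantity, the
  radii of \<open>F\<close> and of \<open>F ^^ k\<close> can be chosen independently of each
  other.\<close>

definition pattern_growth :: "('a config \<Rightarrow> 'a config) \<Rightarrow> ereal" where
  "pattern_growth F = limsup (\<lambda>n. ereal (cover_entropy (pattern_partition n) F / real n))"

text \<open>The two entropy bounds differ only by the margin \<open>k * r\<close> in the box size,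
  which \<open>limsup_shift_div\<close> removes.\<close>

lemma pattern_growth_power:
  fixes F :: "('a::finite) config \<Rightarrow> 'a config"
  assumes "has_radius F r" "k > 0"
  shows "pattern_growth (F ^^ k) = ereal (real k) * pattern_growth F"
proof -
  let ?h = "\<lambda>n. cover_entropy (pattern_partition n) F"
  let ?hk = "\<lambda>n. cover_entropy (pattern_partition n) (F ^^ k)"
  have scaled: "ereal (real k) * pattern_growth F = limsup (\<lambda>n. ereal (real k * ?h n / real n))"
    unfolding pattern_growth_def using Limsup_ereal_mult_left[of sequentially "real k" "\<lambda>n. ereal (?h n / real n)"]
    by simp
  show ?thesis
  proof (rule antisym)
    show "pattern_growth (F ^^ k) \<le> ereal (real k) * pattern_growth F"
      unfolding scaled unfolding pattern_growth_def
      by (intro Limsup_mono always_eventually allI)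
        (simp add: divide_right_mono pattern_entropy_power_le[OF assms(2)])
    have "limsup (\<lambda>n. ereal (real k * ?h n / real n)) \<le> limsup (\<lambda>n. ereal (?hk (n + k * r) / real n))"
      by (intro Limsup_mono always_eventually allI)
        (simp add: divide_right_mono pattern_entropy_le_power[OF assms])
    then show "ereal (real k) * pattern_growth F \<le> pattern_growth (F ^^ k)"
      unfolding scaled limsup_shift_div[of ?hk "k * r"] unfolding pattern_growth_def .
  qed
qed

section \<open>Frames, rings and boxes\<close>

lemma topspace_config_topology [simp]: "topspace config_topology = UNIV"
  unfolding config_topology_def by simp

lemma openin_cylinder:
  assumes "finite D"
  shows "openin config_topology {y. \<forall>u\<in>D. y u = x u}"
proof -
  have "{y. \<forall>u\<in>D. y u = x u} = (\<Pi>\<^sub>E u\<in>UNIV. if u \<in> D then {x u} else UNIV)"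
    by (fastforce simp: PiE_iff split: if_splits)
  moreover have "openin config_topology (\<Pi>\<^sub>E u\<in>UNIV. if u \<in> D then {x u} else UNIV)"
    unfolding config_topology_def
    by (rule product_topology_basis) (auto intro: finite_subset[OF _ assms])
  ultimately show ?thesis by simp
qed

text \<open>A basic open set of the product constrains finitely many coordinates, and these lie in
  one box.\<close>

lemma open_contains_cylinder:
  assumes "openin config_topology S" "x \<in> S"
  shows "\<exists>m. {y. \<forall>u\<in>E m. y u = x u} \<subseteq> S"
proof -
  obtain U where U: "finite {i. U i \<noteq> UNIV}" "x \<in> (\<Pi>\<^sub>E i\<in>UNIV. U i)" "(\<Pi>\<^sub>E i\<in>UNIV. U i) \<subseteq> S"
    using assms unfolding config_topology_def openin_product_topology_alt by auto
  obtain m where m: "{i. U i \<noteq> UNIV} \<subseteq> E m" using finite_subset_E[OF U(1)] ..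
  have "y \<in> S" if "\<forall>u\<in>E m. y u = x u" for y
  proof -
    have "y i \<in> U i" for i
    proof (cases "U i = UNIV")
      case False
      then have "y i = x i" using m that by auto
      then show ?thesis using U(2) by auto
    qed simp
    then show ?thesis using U(3) by (auto simp: PiE_iff)
  qed
  then show ?thesis by auto
qed

lemma compact_config_space: "compact_space (config_topology :: ('a::finite) config topology)"
  unfolding config_topology_def compact_space_product_topology
  by (simp add: compact_space_discrete_topology)

text \<open>A Lebesgue number argument: finitely many cylinders, each inside a member of
  \<open>C\<close>, cover the compact space, and the largest of their boxes serves for all
  points.\<close>

lemma pattern_partition_refines_open_cover:
  fixes C :: "('a::finite) config set set"
  assumes "finite_open_cover C"
  shows "\<exists>m. cover_refines (pattern_partition m) C"
proof -
  let ?cyl = "\<lambda>m (x :: 'a config). {y. \<forall>u\<in>E m. y u = x u}"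
  have C: "\<forall>S\<in>C. openin config_topology S" "covers C"
    using assms unfolding finite_open_cover_def by auto
  have "\<exists>m. \<exists>S\<in>C. ?cyl m x \<subseteq> S" for x
  proof -
    obtain S where "S \<in> C" "x \<in> S" using coversD[OF C(2), of x] by auto
    then show ?thesis using open_contains_cylinder[of S x] C(1) by auto
  qed
  then have "\<forall>x. \<exists>m. \<exists>S\<in>C. ?cyl m x \<subseteq> S" by (rule allI)
  \<comment> \<open>Here \<open>r x\<close> is a box size adapted to the point \<open>x\<close>, not
    the radius of an automaton.\<close>
  then obtain r where "\<forall>x. \<exists>S\<in>C. ?cyl (r x) x \<subseteq> S" unfolding choice_iff ..
  then have r: "\<exists>S\<in>C. ?cyl (r x) x \<subseteq> S" for x by (rule spec)
  have "\<exists>\<F>. finite \<F> \<and> \<F> \<subseteq> range (\<lambda>x. ?cyl (r x) x) \<and> topspace config_topology \<subseteq> \<Union>\<F>"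
    using compact_config_space
    by (intro compactinD[of config_topology "topspace config_topology"])
      (auto simp: compact_space_def openin_cylinder finite_E)
  then obtain \<F> where \<F>: "finite \<F>" "\<F> \<subseteq> range (\<lambda>x. ?cyl (r x) x)" "UNIV \<subseteq> \<Union>\<F>" by auto
  obtain X where X: "finite X" "\<F> = (\<lambda>x. ?cyl (r x) x) ` X"
    using finite_subset_image[OF \<F>(1,2)] by auto
  define m where "m = Max (insert 0 (r ` X))"
  have "cover_refines (pattern_partition m) C"
    unfolding cover_refines_def pattern_partition_def
  proof (intro ballI)
    fix A assume "A \<in> range (\<lambda>x. ?cyl m x)"
    then obtain x where A: "A = ?cyl m x" by auto
    obtain z where z: "z \<in> X" "x \<in> ?cyl (r z) z" using \<F>(3) X(2) by blast
    have "r z \<le> m" unfolding m_def using X(1) z(1) by (intro Max_ge) auto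
    then have "E (r z) \<subseteq> E m" by (rule E_mono)
    \<comment> \<open>Agreement with \<open>x\<close> on the larger box gives agreement with
      \<open>z\<close> on \<open>E (r z)\<close>, since \<open>x\<close> and \<open>z\<close> agree
      there.\<close>
    then have "A \<subseteq> ?cyl (r z) z" using z(2) unfolding A by auto
    then show "\<exists>B\<in>C. A \<subseteq> B" using r[of z] by (meson subset_trans)
  qed
  then show ?thesis ..
qed

lemma finite_open_cover_pattern_partition:
  "finite_open_cover (pattern_partition n :: ('a::finite) config set set)"
proof -
  have "openin config_topology S" if "S \<in> pattern_partition n" for S :: "'a config set"
    using that unfolding pattern_partition_def by (auto simp: openin_cylinder finite_E)
  then show ?thesis
    unfolding finite_open_cover_def using finite_pattern_partition covers_pattern_partition by auto
qed

text \<open>The easy half of the Curtis--Hedlund--Lyndon theorem.\<close>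
lemma cellular_automaton_has_radius:
  fixes F :: "('a::finite) config \<Rightarrow> 'a config"
  assumes "cellular_automaton F"
  shows "\<exists>r. has_radius F r"
proof -
  have cont: "continuous_map config_topology config_topology F"
    and shift: "\<And>v x. F (shift v x) = shift v (F x)"
    using assms unfolding cellular_automaton_def by auto
  \<comment> \<open>The level sets of the value at the origin form a finite open cover; refining it
    by patterns expresses that this value depends on one box only.\<close>
  let ?C = "(\<lambda>a. {x. F x 0 = a}) ` UNIV"
  have "continuous_map config_topology (discrete_topology UNIV) (\<lambda>x. F x 0)"
    using cont unfolding config_topology_def continuous_map_componentwise_UNIV by blast
  then have "openin config_topology {x. F x 0 = a}" for a
    using openin_continuous_map_preimage[of config_topology "discrete_topology UNIV" "\<lambda>x. F x 0" "{a}"]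
    by simp
  then have "finite_open_cover ?C"
    unfolding finite_open_cover_def by (auto intro: coversI)
  then obtain r where r: "cover_refines (pattern_partition r) ?C"
    using pattern_partition_refines_open_cover by auto
  have local: "F x 0 = F y 0" if "\<forall>u\<in>E r. x u = y u" for x y
  proof -
    have "{y. \<forall>u\<in>E r. y u = x u} \<in> pattern_partition r" unfolding pattern_partition_def by auto
    then obtain a where "{y. \<forall>u\<in>E r. y u = x u} \<subseteq> {x. F x 0 = a}"
      using r unfolding cover_refines_def by auto
    then show ?thesis using that by auto
  qed
  have "F x z = F (restrict (\<lambda>u. x (z + u)) (E r)) 0" for x z
  proof -
    have "F x z = F (shift z x) 0" unfolding shift by (simp add: shift_def)
    also have "\<dots> = F (restrict (\<lambda>u. x (z + u)) (E r)) 0"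
      by (rule local) (simp add: shift_def add.commute)
    finally show ?thesis .
  qed
  then have "has_radius F r"
    unfolding has_radius_def by (intro exI[of _ "\<lambda>p. F p 0"]) simp
  then show ?thesis ..
qed

section \<open>Frame covers and the upper bound for the entropy rate\<close>

lemma shift_shift: "shift v (shift w x) = shift (w + v) x"
  unfolding shift_def by (simp add: add.assoc add.commute[of v w])

lemma shift_0: "shift 0 x = x"
  unfolding shift_def by simp

lemma finite_frame: "finite (frame r n)"
  unfolding frame_def using finite_E by simp

lemma finite_frame_cover: "finite C \<Longrightarrow> finite (frame_cover r C n)"
  unfolding frame_cover_def by (intro finite_join finite_frame finite_imageI)

lemma covers_frame_cover:
  assumes "covers C"
  shows "covers (frame_cover r C n)"
  unfolding frame_cover_def
proof (rule covers_join, rule coversI)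
  fix v and x :: "'a config"
  obtain S where S: "S \<in> C" "shift (- v) x \<in> S" using coversD[OF assms] by auto
  have "x = shift v (shift (- v) x)" by (simp add: shift_shift shift_0)
  then have "x \<in> shift v ` S" using S(2) by (rule image_eqI)
  then show "\<exists>A\<in>(\<lambda>S. shift v ` S) ` C. x \<in> A" using S(1) by auto
qed

lemma pattern_partition_refines_frame_cover:
  assumes "cover_refines (pattern_partition m) C"
  shows "cover_refines (pattern_partition (n + m)) (frame_cover r C n)"
  unfolding cover_refines_def
proof
  fix A :: "'a config set" assume "A \<in> pattern_partition (n + m)"
  then obtain x where A: "A = {y. \<forall>u\<in>E (n + m). y u = x u}"
    unfolding pattern_partition_def by auto
  have "\<forall>v. \<exists>S. S \<in> C \<and> {y. \<forall>u\<in>E m. y u = shift (- v) x u} \<subseteq> S"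
    using assms unfolding cover_refines_def pattern_partition_def by auto
  then obtain S where "\<forall>v. S v \<in> C \<and> {y. \<forall>u\<in>E m. y u = shift (- v) x u} \<subseteq> S v"
    unfolding choice_iff ..
  then have S: "S v \<in> C" "{y. \<forall>u\<in>E m. y u = shift (- v) x u} \<subseteq> S v" for v by blast+
  have "(\<Inter>v\<in>frame r n. shift v ` S v) \<in> frame_cover r C n"
    unfolding frame_cover_def by (rule join_memI) (use S(1) in auto)
  moreover have "A \<subseteq> (\<Inter>v\<in>frame r n. shift v ` S v)"
  proof (intro subsetI INT_I)
    fix y v assume y: "y \<in> A" and v: "v \<in> frame r n"
    have "shift (- v) y u = shift (- v) x u" if "u \<in> E m" for u
    proof -
      have "- v \<in> E n" using v unfolding frame_def by (simp add: uminus_mem_E)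
      then have "u + - v \<in> E (n + m)" using add_mem_E[OF _ that, of "- v" n] by (simp add: add.commute)
      then show ?thesis using y unfolding A shift_def by auto
    qed
    then have "shift (- v) y \<in> S v" using S(2)[of v] by auto
    then have "shift v (shift (- v) y) \<in> shift v ` S v" by (rule imageI)
    then show "y \<in> shift v ` S v" by (simp add: shift_shift shift_0)
  qed
  ultimately show "\<exists>B\<in>frame_cover r C n. A \<subseteq> B" by (rule bexI[rotated])
qed

lemma ER_cover_le_pattern_growth:
  fixes F :: "('a::finite) config \<Rightarrow> 'a config"
  assumes "finite_open_cover C"
  shows "ER_cover r C F \<le> pattern_growth F"
proof -
  have C: "finite C" "covers C" using assms unfolding finite_open_cover_def by auto
  obtain m where m: "cover_refines (pattern_partition m) C"
    using pattern_partition_refines_open_cover[OF assms] ..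
  have "cover_entropy (frame_cover r C n) F \<le> cover_entropy (pattern_partition (n + m)) F" for n
    by (intro cover_entropy_mono finite_pattern_partition covers_pattern_partition finite_frame_cover
        covers_frame_cover pattern_partition_refines_frame_cover C m)
  then have "ER_cover r C F \<le> limsup (\<lambda>n. ereal (cover_entropy (pattern_partition (n + m)) F / real n))"
    unfolding ER_cover_def by (intro Limsup_mono always_eventually allI) (simp add: divide_right_mono)
  then show ?thesis
    unfolding pattern_growth_def limsup_shift_div[of "\<lambda>n. cover_entropy (pattern_partition n) F" m] .
qed

section \<open>Rings and the lower bound for the entropy rate\<close>

text \<open>
  The cells of the ring around \<open>E n\<close> supply the boundary condition under which \<open>F\<close> can be
  iterated on \<open>E (n + r)\<close> from the initial pattern alone.
\<close>
lemma ring_determines_trace: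
  assumes F: "has_radius F r"
    and init: "\<forall>u\<in>E (n + r). x u = y u"
    and ring: "\<And>i u. i < N \<Longrightarrow> u \<in> E (n + r) - E n \<Longrightarrow> (F ^^ i) x u = (F ^^ i) y u"
  shows "i < N \<Longrightarrow> \<forall>u\<in>E (n + r). (F ^^ i) x u = (F ^^ i) y u"
proof (induction i)
  case (Suc i)
  then have "\<forall>u\<in>E n. (F ^^ Suc i) x u = (F ^^ Suc i) y u"
    using has_radius_cong[OF F] by simp
  then show ?case using ring[OF Suc.prems] by auto
qed (use init in simp)

text \<open>The number of initial patterns does not depend on \<open>N\<close>, so only the count of
  \<open>\<psi>\<close> affects the entropy. The observable \<open>\<psi>\<close> is left abstract
  to serve both for members of a frame subcover and for families of box itineraries.\<close>

lemma trace_count_le_ring: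
  fixes F :: "('a::finite) config \<Rightarrow> 'a config"
  assumes F: "has_radius F r"
    and fin: "finite (range \<psi>)"
    and ring: "\<And>x y i u. \<psi> x = \<psi> y \<Longrightarrow> i < N \<Longrightarrow> u \<in> E (n + r) - E n \<Longrightarrow> (F ^^ i) x u = (F ^^ i) y u"
  shows "trace_count F (E (n + r)) N
    \<le> card (range (pat (E (n + r)) :: 'a config \<Rightarrow> 'a config)) * card (range \<psi>)"
proof -
  let ?P = "range (pat (E (n + r)) :: 'a config \<Rightarrow> 'a config)"
  let ?g = "\<lambda>x. (pat (E (n + r)) x, \<psi> x)"
  have finP: "finite (?P \<times> range \<psi>)" by (intro finite_cartesian_product finite_range_pat finite_E fin)
  have sub: "range ?g \<subseteq> ?P \<times> range \<psi>" by auto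
  have "trace_count F (E (n + r)) N \<le> card (range ?g)"
    unfolding trace_count_def
  proof (rule card_range_le[OF finite_subset[OF sub finP]])
    fix x y assume "?g x = ?g y"
    then have "\<forall>u\<in>E (n + r). x u = y u" "\<psi> x = \<psi> y" by (auto simp: pat_eq_iff)
    then show "itinerary F (pat (E (n + r))) N x = itinerary F (pat (E (n + r))) N y"
      unfolding itinerary_pat_eq_iff using ring_determines_trace[OF F, of n x y N] ring[of x y]
      by blast
  qed
  also have "\<dots> \<le> card (?P \<times> range \<psi>)" by (rule card_mono[OF finP sub])
  finally show ?thesis by (simp add: card_cartesian_product)
qed

text \<open>An additive constant disappears after division by \<open>N\<close>.\<close>

lemma rate_le:
  fixes f g :: "nat \<Rightarrow> real"
  assumes "\<And>N. f N \<le> c + g N"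
    and "(\<lambda>N. f N / real N) \<longlonglongrightarrow> a" "(\<lambda>N. g N / real N) \<longlonglongrightarrow> b"
  shows "a \<le> b"
proof -
  have "(\<lambda>N. c / real N + g N / real N) \<longlonglongrightarrow> 0 + b"
    by (intro tendsto_add assms(3) lim_const_over_n)
  moreover have "f N / real N \<le> c / real N + g N / real N" for N
    using divide_right_mono[OF assms(1)[of N], of "real N"] by (simp add: add_divide_distrib)
  ultimately show ?thesis using LIMSEQ_le[OF assms(2)] by auto
qed

text \<open>
  The site \<open>v\<close> of the frame whose \<open>r\<close>-box sees \<open>u\<close> is minus the point of \<open>E n\<close> closest to \<open>u\<close>;
  the sign comes from \<open>shift v ` S\<close> reading the configuration around \<open>- v\<close>.
\<close>
lemma frame_cover_pattern_cong:
  assumes n: "n > 0" and A: "A \<in> frame_cover r (pattern_partition r) n"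
    and xy: "x \<in> A" "y \<in> A" and u: "u \<in> E (n + r) - E n"
  shows "x u = y u"
proof -
  obtain S where S: "\<And>v. v \<in> frame r n \<Longrightarrow> S v \<in> (\<lambda>S. shift v ` S) ` pattern_partition r"
    "A = (\<Inter>v\<in>frame r n. S v)"
    using A unfolding frame_cover_def by (rule join_memE) auto
  obtain i j where ij: "u = (i, j)" by (cases u)
  \<comment> \<open>Clamping both coordinates of \<open>u\<close> to \<open>[-n, n]\<close> gives
    its closest point in \<open>E n\<close>.\<close>
  define c :: "int \<Rightarrow> int" where "c t = max (- int n) (min (int n) t)" for t
  define v where "v = (- c i, - c j)"
  \<comment> \<open>Some coordinate of \<open>u\<close> exceeds \<open>n\<close> in absolute value
    and is clamped to \<open>n\<close> or \<open>-n\<close>. Since \<open>u\<close> lies in the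
    ring, \<open>r > 0\<close>; together with \<open>n > 0\<close> this makes the truncated
    \<open>n - r\<close> smaller than \<open>n\<close>.\<close>
  have "v \<in> frame r n" using u n unfolding frame_def v_def ij c_def by (auto simp: mem_E)
  moreover have uv: "u + v \<in> E r" using u unfolding v_def ij c_def by (auto simp: mem_E)
  ultimately have "S v \<in> (\<lambda>S. shift v ` S) ` pattern_partition r" and xyv: "x \<in> S v" "y \<in> S v"
    using S xy by auto
  then obtain p where p: "S v = shift v ` {y. \<forall>w\<in>E r. y w = p w}"
    unfolding pattern_partition_def by blast
  have "z u = p (u + v)" if "z \<in> S v" for z
    using that uv unfolding p by (auto simp: shift_def)
  from this[OF xyv(1)] this[OF xyv(2)] show ?thesis by simp
qed

text \<open>A member of the iterated frame cover fixes the history of the ring. Thus the square has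
  at most a constant times as many traces as a minimal subcover has members.\<close>

lemma pattern_entropy_le_frame:
  fixes F :: "('a::finite) config \<Rightarrow> 'a config"
  assumes F: "has_radius F r" and n: "n > 0"
  shows "cover_entropy (pattern_partition (n + r)) F
    \<le> cover_entropy (frame_cover r (pattern_partition r) n) F"
proof -
  define Q :: "'a config set set" where "Q = frame_cover r (pattern_partition r) n"
  define c where "c = card (range (pat (E (n + r)) :: 'a config \<Rightarrow> 'a config))"
  have c: "0 < c" unfolding c_def by (intro card_range_pos finite_range_pat finite_E)
  have Q: "finite Q" "covers Q" unfolding Q_def
    by (intro finite_frame_cover covers_frame_cover finite_pattern_partition covers_pattern_partition)+
  have fin: "finite (iterate_cover F Q N)" and cov: "covers (iterate_cover F Q N)" for N
    by (intro finite_iterate_cover covers_iterate_cover Q)+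
  have "trace_count F (E (n + r)) N \<le> c * min_subcover (iterate_cover F Q N)" for N
  proof -
    obtain W where W: "W \<subseteq> iterate_cover F Q N" "finite W" "covers W"
      "card W = min_subcover (iterate_cover F Q N)"
      by (rule min_subcover_obtain[OF fin cov])
    have "\<forall>x. \<exists>A. A \<in> W \<and> x \<in> A" using coversD[OF W(3)] by auto
    \<comment> \<open>Choosing a member of \<open>W\<close> around each point turns the subcover
      into an observable with at most \<open>card W\<close> values.\<close>
    then obtain \<psi> where \<psi>: "\<And>x. \<psi> x \<in> W" "\<And>x. x \<in> \<psi> x" by metis
    have sub: "range \<psi> \<subseteq> W" using \<psi>(1) by auto
    have "trace_count F (E (n + r)) N \<le> c * card (range \<psi>)"
      unfolding c_def
    proof (rule trace_count_le_ring[OF F finite_subset[OF sub W(2)]])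
      fix x y i u assume eq: "\<psi> x = \<psi> y" and i: "i < N" and u: "u \<in> E (n + r) - E n"
      have "\<psi> x \<in> iterate_cover F Q N" using \<psi>(1) W(1) by auto
      then obtain U where U: "\<And>i. i \<in> {..<N} \<Longrightarrow> U i \<in> preimage_cover (F ^^ i) Q"
        "\<psi> x = (\<Inter>i\<in>{..<N}. U i)"
        unfolding iterate_cover_def by (rule join_memE) auto
      obtain A where A: "A \<in> Q" "U i = (F ^^ i) -` A"
        using U(1)[of i] i unfolding preimage_cover_def by auto
      have "x \<in> U i" "y \<in> U i" using \<psi>(2)[of x] \<psi>(2)[of y] i unfolding eq[symmetric] U(2) by auto
      then have "(F ^^ i) x \<in> A" "(F ^^ i) y \<in> A" unfolding A(2) by auto
      then show "(F ^^ i) x u = (F ^^ i) y u"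
        using A(1) u unfolding Q_def by (intro frame_cover_pattern_cong[OF n])
    qed
    also have "\<dots> \<le> c * card W" using card_mono[OF W(2) sub] by simp
    finally show ?thesis unfolding W(4) .
  qed
  then have "ln (real (trace_count F (E (n + r)) N)) \<le> ln (real (c * min_subcover (iterate_cover F Q N)))" for N
    using trace_count_pos[OF finite_E, of F "n + r" N] c min_subcover_pos[OF fin cov, of N]
    by (simp del: of_nat_mult)
  moreover have "ln (real (c * min_subcover (iterate_cover F Q N))) = ln (real c) + H (iterate_cover F Q N)" for N
    unfolding H_def using c min_subcover_pos[OF fin cov, of N] by (simp add: ln_mult)
  ultimately have "ln (real (trace_count F (E (n + r)) N)) \<le> ln (real c) + H (iterate_cover F Q N)" for N
    by simp
  then show ?thesis
    unfolding Q_def[symmetric] by (rule rate_le[OF _ pattern_entropy_LIMSEQ cover_entropy_LIMSEQ[OF Q]])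
qed

text \<open>The supremum over covers is attained at \<open>pattern_partition r\<close>, whose
  translates over the frame see the whole ring of width \<open>r\<close>.\<close>

lemma ER_eq_pattern_growth:
  fixes F :: "('a::finite) config \<Rightarrow> 'a config"
  assumes "has_radius F r"
  shows "ER r F = pattern_growth F"
proof (rule antisym)
  show "ER r F \<le> pattern_growth F"
    unfolding ER_def by (intro SUP_least) (simp add: ER_cover_le_pattern_growth)
  let ?h = "\<lambda>n. cover_entropy (pattern_partition n) F"
  have "pattern_growth F = limsup (\<lambda>n. ereal (?h (n + r) / real n))"
    unfolding pattern_growth_def limsup_shift_div[of ?h r] ..
  also have "\<dots> \<le> ER_cover r (pattern_partition r) F"
    unfolding ER_cover_def
    by (intro Limsup_mono eventually_mono[OF eventually_gt_at_top[of 0]])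
      (simp add: divide_right_mono pattern_entropy_le_frame[OF assms])
  also have "\<dots> \<le> ER r F"
    unfolding ER_def by (intro SUP_upper) (simp add: finite_open_cover_pattern_partition)
  finally show "pattern_growth F \<le> ER r F" .
qed

section \<open>Covering the ring by boxes\<close>

lemma has_radius_funpow_shift:
  assumes "has_radius F r"
  shows "(F ^^ i) (shift v x) = shift v ((F ^^ i) x)"
  by (induction i) (simp_all add: has_radius_shift[OF assms])

text \<open>Rounding is done on the absolute value and the sign restored afterwards, which keeps the
  multiplier symmetric about 0.\<close>

lemma multiple_near:
  fixes j :: int
  assumes "\<bar>j\<bar> \<le> int n" "m > 0"
  shows "\<exists>t\<in>{- int (n div m)..int (n div m)}. \<bar>j - t * int m\<bar> \<le> int m"
proof -
  have le: "\<bar>j\<bar> div int m \<le> int (n div m)" using assms by (simp add: zdiv_int zdiv_mono1)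
  have nonneg: "0 \<le> \<bar>j\<bar> div int m" using assms by (simp add: pos_imp_zdiv_nonneg_iff)
  have "\<bar>j\<bar> = (\<bar>j\<bar> div int m) * int m + \<bar>j\<bar> mod int m" by simp
  moreover have "0 \<le> \<bar>j\<bar> mod int m" "\<bar>j\<bar> mod int m < int m" using assms by auto
  ultimately have near: "\<bar>\<bar>j\<bar> - (\<bar>j\<bar> div int m) * int m\<bar> \<le> int m" by linarith
  show ?thesis
  proof (cases "j \<ge> 0")
    case True
    then show ?thesis using le nonneg near by (intro bexI[of _ "\<bar>j\<bar> div int m"]) auto
  next
    case False
    then show ?thesis using le nonneg near by (intro bexI[of _ "- (\<bar>j\<bar> div int m)"]) auto
  qed
qed

text \<open>
  The centres lie on the boundary of \<open>E (n + r)\<close> at spacing \<open>m\<close>: with four sides of length about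
  \<open>2 n\<close> this takes about \<open>8 n / m\<close> boxes, which is where the factor 8 comes from.
\<close>
lemma ring_covered_by_boxes:
  assumes "r \<le> m" "m > 0"
  obtains K where "finite K" "card K \<le> 8 * ((n + r) div m) + 4"
    "\<And>u. u \<in> E (n + r) - E n \<Longrightarrow> \<exists>c\<in>K. u - c \<in> E m"
proof -
  define q where "q = (n + r) div m"
  define J where "J = (\<lambda>t. t * int m) ` {- int q..int q}"
  define B where "B = {int (n + r), - int (n + r)}"
  have finJ: "finite J" and finB: "finite B" unfolding J_def B_def by auto
  have cardJ: "card J \<le> 2 * q + 1"
    unfolding J_def using card_image_le[of "{- int q..int q}" "\<lambda>t. t * int m"] by simp
  have cardB: "card B \<le> 2" unfolding B_def by (simp add: card_insert_if)
  have "card (B \<times> J \<union> J \<times> B) \<le> card B * card J + card J * card B"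
    using card_Un_le[of "B \<times> J" "J \<times> B"] by (simp add: card_cartesian_product)
  \<comment> \<open>Two sides in each direction with at most \<open>2 * q + 1\<close> centres each;
    common centres are not subtracted.\<close>
  also have "\<dots> \<le> 2 * (2 * q + 1) + (2 * q + 1) * 2"
    using cardB cardJ by (intro add_mono mult_le_mono)
  finally have card: "card (B \<times> J \<union> J \<times> B) \<le> 8 * q + 4" by simp
  have nearJ: "\<exists>c\<in>J. \<bar>j - c\<bar> \<le> int m" if "\<bar>j\<bar> \<le> int (n + r)" for j
    using multiple_near[OF that assms(2)] unfolding J_def q_def by auto
  \<comment> \<open>This is where \<open>r \<le> m\<close> enters: a coordinate beyond
    \<open>n\<close> is within the ring width \<open>r\<close> of an extreme one.\<close>
  have nearB: "\<exists>c\<in>B. \<bar>i - c\<bar> \<le> int m" if "\<bar>i\<bar> \<le> int (n + r)" "int n < \<bar>i\<bar>" for i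
    using that assms(1) unfolding B_def by auto
  have "\<exists>c\<in>B \<times> J \<union> J \<times> B. u - c \<in> E m" if "u \<in> E (n + r) - E n" for u
  proof -
    obtain i j where u: "u = (i, j)" by (cases u)
    have ij: "\<bar>i\<bar> \<le> int (n + r)" "\<bar>j\<bar> \<le> int (n + r)" "int n < \<bar>i\<bar> \<or> int n < \<bar>j\<bar>"
      using that unfolding u Diff_iff mem_E by auto
    from ij(3) show ?thesis
    proof
      assume "int n < \<bar>i\<bar>"
      then obtain b c where "b \<in> B" "\<bar>i - b\<bar> \<le> int m" "c \<in> J" "\<bar>j - c\<bar> \<le> int m"
        using nearB[OF ij(1)] nearJ[OF ij(2)] by auto
      then show ?thesis by (intro bexI[of _ "(b, c)"]) (auto simp: u mem_E)
    next
      assume "int n < \<bar>j\<bar>"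
      then obtain b c where "b \<in> B" "\<bar>j - b\<bar> \<le> int m" "c \<in> J" "\<bar>i - c\<bar> \<le> int m"
        using nearB[OF ij(2)] nearJ[OF ij(1)] by auto
      then show ?thesis by (intro bexI[of _ "(c, b)"]) (auto simp: u mem_E)
    qed
  qed
  then show ?thesis using card finJ finB unfolding q_def by (intro that[of "B \<times> J \<union> J \<times> B"]) auto
qed

text \<open>The boxes around the centres in \<open>K\<close> jointly record the ring. As
  \<open>F\<close> commutes with shifts, the history in the box around \<open>c\<close> is an
  itinerary over \<open>E m\<close> started from \<open>shift c x\<close>, so each box contributes
  at most \<open>trace_count F (E m) N\<close>.\<close>

lemma pattern_entropy_le_boxes:
  fixes F :: "('a::finite) config \<Rightarrow> 'a config"
  assumes F: "has_radius F r" and m: "r \<le> m" "m > 0"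
  shows "cover_entropy (pattern_partition (n + r)) F
    \<le> real (8 * ((n + r) div m) + 4) * cover_entropy (pattern_partition m) F"
proof -
  obtain K where K: "finite K" "card K \<le> 8 * ((n + r) div m) + 4"
    "\<And>u. u \<in> E (n + r) - E n \<Longrightarrow> \<exists>c\<in>K. u - c \<in> E m"
    by (rule ring_covered_by_boxes[OF m, of n]) blast
  define p where "p = card (range (pat (E (n + r)) :: 'a config \<Rightarrow> 'a config))"
  have p: "0 < p" unfolding p_def by (intro card_range_pos finite_range_pat finite_E)
  have "trace_count F (E (n + r)) N \<le> p * trace_count F (E m) N ^ card K" for N
  proof -
    let ?g = "\<lambda>c x. itinerary F (pat (E m)) N (shift c x)"
    let ?\<psi> = "\<lambda>x. restrict (\<lambda>c. ?g c x) K"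
    have sub: "range (?g c) \<subseteq> range (itinerary F (pat (E m)) N)" for c by auto
    have fin: "finite (range (itinerary F (pat (E m)) N))"
      by (rule finite_range_itinerary_pat[OF finite_E])
    have fing: "finite (range (?g c))" for c by (rule finite_subset[OF sub fin])
    have "range ?\<psi> \<subseteq> (\<Pi>\<^sub>E c\<in>K. range (?g c))" by auto
    then have fin\<psi>: "finite (range ?\<psi>)" by (rule finite_subset) (intro finite_PiE K(1) fing)
    have "trace_count F (E (n + r)) N \<le> p * card (range ?\<psi>)"
      unfolding p_def
    proof (rule trace_count_le_ring[OF F fin\<psi>])
      fix x y i u assume eq: "?\<psi> x = ?\<psi> y" and i: "i < N" and u: "u \<in> E (n + r) - E n"
      obtain c where c: "c \<in> K" "u - c \<in> E m" using K(3)[OF u] by auto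
      have "?g c x = ?g c y" using eq c(1) unfolding restrict_eq_iff by auto
      then have "shift c ((F ^^ i) x) (u - c) = shift c ((F ^^ i) y) (u - c)"
        using i c(2) unfolding itinerary_pat_eq_iff has_radius_funpow_shift[OF F] by auto
      then show "(F ^^ i) x u = (F ^^ i) y u" by (simp add: shift_def)
    qed
    also have "card (range ?\<psi>) \<le> (\<Prod>c\<in>K. card (range (?g c)))"
      by (rule card_range_le_prod[OF K(1) fing]) (simp add: restrict_eq_iff)
    also have "\<dots> \<le> (\<Prod>c\<in>K. trace_count F (E m) N)"
      unfolding trace_count_def by (intro prod_mono conjI card_mono[OF fin sub]) simp
    finally show ?thesis by simp
  qed
  then have le: "ln (real (trace_count F (E (n + r)) N)) \<le> ln (real (p * trace_count F (E m) N ^ card K))" for N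
    using trace_count_pos[OF finite_E, of F "n + r" N] trace_count_pos[OF finite_E, of F m N] p
    by (simp del: of_nat_mult of_nat_power)
  have eq: "ln (real (p * trace_count F (E m) N ^ card K))
      = ln (real p) + real (card K) * ln (real (trace_count F (E m) N))" for N
    using trace_count_pos[OF finite_E, of F m N] p by (simp add: ln_mult ln_realpow)
  have bound: "ln (real (trace_count F (E (n + r)) N))
      \<le> ln (real p) + real (card K) * ln (real (trace_count F (E m) N))" for N
    using le[of N] unfolding eq .
  have lim: "(\<lambda>N. real (card K) * ln (real (trace_count F (E m) N)) / real N)
      \<longlonglongrightarrow> real (card K) * cover_entropy (pattern_partition m) F"
    using tendsto_mult_left[OF pattern_entropy_LIMSEQ[of F m], of "real (card K)"] by simp
  have "cover_entropy (pattern_partition (n + r)) F \<le> real (card K) * cover_entropy (pattern_partition m) F"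
    by (rule rate_le[OF bound pattern_entropy_LIMSEQ lim])
  also have "\<dots> \<le> real (8 * ((n + r) div m) + 4) * cover_entropy (pattern_partition m) F"
    using K(2) by (intro mult_right_mono cover_entropy_nonneg finite_pattern_partition
        covers_pattern_partition) simp
  finally show ?thesis .
qed

text \<open>With \<open>m\<close> fixed and \<open>n\<close> growing, the number of boxes divided by
  \<open>n\<close> tends to at most \<open>8 / m\<close>; the additive 4 vanishes in the
  limit.\<close>

lemma pattern_growth_le_box:
  fixes F :: "('a::finite) config \<Rightarrow> 'a config"
  assumes F: "has_radius F r" and m: "r \<le> m" "m > 0"
  shows "pattern_growth F \<le> ereal (8 * (cover_entropy (pattern_partition m) F / real m))"
proof -
  define h where "h n = cover_entropy (pattern_partition n) F" for n
  have nonneg: "0 \<le> h m" unfolding h_def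
    by (intro cover_entropy_nonneg finite_pattern_partition covers_pattern_partition)
  have "h n / real n \<le> 8 * (h m / real m) + 4 * h m / real n" if n: "n > 0" "n \<ge> r" for n
  proof -
    \<comment> \<open>The box bound is used for the inner square \<open>E (n - r)\<close>, which
      requires \<open>n \<ge> r\<close>.\<close>
    have "h n \<le> real (8 * (n div m) + 4) * h m"
      using pattern_entropy_le_boxes[OF F m, of "n - r"] n unfolding h_def by simp
    also have "\<dots> \<le> (8 * (real n / real m) + 4) * h m"
      using of_nat_div_le_of_nat[of n m, where ?'a = real] nonneg by (intro mult_right_mono) auto
    finally have "h n / real n \<le> (8 * (real n / real m) + 4) * h m / real n"
      by (rule divide_right_mono) simp
    also have "\<dots> = 8 * (h m / real m) + 4 * h m / real n"
      using n m by (simp add: field_simps)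
    finally show ?thesis .
  qed
  then have "pattern_growth F \<le> limsup (\<lambda>n. ereal (8 * (h m / real m) + 4 * h m / real n))"
    unfolding pattern_growth_def h_def[symmetric]
    by (intro Limsup_mono eventually_mono[OF eventually_gt_at_top[of r]]) auto
  also have "\<dots> = ereal (8 * (h m / real m))"
  proof (rule lim_imp_Limsup)
    have "(\<lambda>n. 8 * (h m / real m) + 4 * h m / real n) \<longlonglongrightarrow> 8 * (h m / real m) + 0"
      by (intro tendsto_add tendsto_const lim_const_over_n)
    then show "(\<lambda>n. ereal (8 * (h m / real m) + 4 * h m / real n)) \<longlonglongrightarrow> ereal (8 * (h m / real m))"
      by simp
  qed simp
  finally show ?thesis unfolding h_def .
qed

theorem proposition16:
  fixes F :: "('a::finite) config \<Rightarrow> 'a config"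
  assumes "cellular_automaton F"
  shows "(\<forall>k r r'. k > 0 \<longrightarrow> has_radius F r \<longrightarrow> has_radius (F ^^ k) r' \<longrightarrow>
            ER r' (F ^^ k) = ereal (real k) * ER r F) \<and>
         limsup (\<lambda>n. ereal (cover_entropy (pattern_partition n) F / real n))
           \<le> 8 * liminf (\<lambda>n. ereal (cover_entropy (pattern_partition n) F / real n))"
proof (intro conjI allI impI)
  fix k r r' assume "k > 0" "has_radius F r" "has_radius (F ^^ k) r'"
  then show "ER r' (F ^^ k) = ereal (real k) * ER r F"
    by (simp add: ER_eq_pattern_growth pattern_growth_power)
next
  let ?f = "\<lambda>n. cover_entropy (pattern_partition n) F / real n"
  obtain r where r: "has_radius F r" using cellular_automaton_has_radius[OF assms] ..
  \<comment> \<open>The left side is free of \<open>n\<close> and the box bound holds for every box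
    size \<open>n > r\<close>, so it passes to the limit inferior.\<close>
  have "pattern_growth F \<le> liminf (\<lambda>n. ereal (8 * ?f n))"
    by (intro Liminf_bounded eventually_mono[OF eventually_gt_at_top[of r]] pattern_growth_le_box[OF r]) auto
  also have "\<dots> = 8 * liminf (\<lambda>n. ereal (?f n))"
    using Liminf_ereal_mult_left[of sequentially 8 "\<lambda>n. ereal (?f n)"] by simp
  finally show "limsup (\<lambda>n. ereal (?f n)) \<le> 8 * liminf (\<lambda>n. ereal (?f n))"
    unfolding pattern_growth_def .
qed

end
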